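(* Let $k$ be any field of characteristic not $2$ and let $H$ be the bosonization of the superline over $k$. Then $H^2_{\mathrm{ad}}(H;H)\cong k^3$ (as a $k$-vector space).
   Context: The bosonization of the superline is the ($4$-dimensional, with basis $1,g,x,gx$) Hopf algebra $H$ over $k$ generated as a unital algebra by $g,x$ with relations $x^2=0$, $g^2=1$, $xg=-gx$, and Hopf structure $\Delta(x)=x\otimes 1+g\otimes x$, $\Delta(g)=g\otimes g$, $\epsilon(x)=0$, $\epsilon(g)=1$, $S(x)=-gx$, $S(g)=g$. For a Hopf algebra $H$ with multiplication $\mu$, comultiplication $\Delta$, antipode $S$, Sweedler notation $\Delta(y)=y_{(1)}\otimes y_{(2)}$ and flip $\tau(a\otimes b)=b\otimes a$, the adjoint map is $\mathrm{ad}(a\otimes y)=S(y_{(1)})\,a\,y_{(2)}$. Put $C^1_{\mathrm{ad}}(H;H)=\{f\in \mathrm{Hom}_k(H,H) : f\mu=\mu(f\otimes 1)+\mu(1\otimes f),\ \Delta f=(f\otimes 1)\Delta+(1\otimes f)\Delta\}$, $C^2_{\mathrm{ad}}(H;H)=\mathrm{Hom}(H^{\otimes 2},H)$, $C^3_{\mathrm{ad}}(H;H)=\mathrm{Hom}(H^{\otimes 3},H)\oplus\mathrm{Hom}(H^{\otimes 2},H^{\otimes 2})$ ($k$-linear maps). Differentials: $D_1:C^1_{\mathrm{ad}}\to C^2_{\mathrm{ad}}$, $D_1(f)=\mathrm{ad}(1\otimes f)-f\,\mathrm{ad}+\mathrm{ad}(f\otimes 1)$; $D_2:C^2_{\mathrm{ad}}\to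 C^3_{\mathrm{ad}}$, $D_2(\phi)=(d^{2,1}(\phi),d^{2,2}(\phi))$ with $d^{2,1}(\phi)=\mathrm{ad}(\phi\otimes 1)+\phi(\mathrm{ad}\otimes 1)-\phi(1\otimes\mu)$, $d^{2,2}(\phi)=(\phi\otimes\mu)(1\otimes\tau\otimes 1)(\Delta\otimes\Delta)-(1\otimes\mu)(\tau\otimes 1)(1\otimes\Delta)(1\otimes\phi)(\tau\otimes 1)(1\otimes\Delta)$. Then $H^2_{\mathrm{ad}}(H;H)=\ker D_2/\mathrm{Im}\,D_1$. *)

theory Defs
  imports
    "HOL-Analysis.Analysis"
    "HOL-Library.Function_Algebras"
    "HOL-Library.Set_Algebras"
begin

section \<open>Tensor products of coordinate spaces\<close>

text \<open>
  The tensor product of \<open>'k^'a\<close> and \<open>'k^'b\<close> is \<open>'k^('a \<times> 'b)\<close>: the standard basis vector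
  with index \<open>(i, j)\<close> is \<open>e\<^sub>i \<otimes> e\<^sub>j\<close>. Bracketings of iterated tensor products are kept apart,
  so the usual identifications appear as explicit associators.
\<close>

definition tensor :: "'k::field^'a \<Rightarrow> 'k^'b \<Rightarrow> 'k^('a \<times> 'b)"  (infixr "\<otimes>\<^sub>v" 75)
  where "v \<otimes>\<^sub>v w = (\<chi> p. v $ fst p * w $ snd p)"

definition tensor_map ::
  "('k::field^'a \<Rightarrow> 'k^'c) \<Rightarrow> ('k^'b \<Rightarrow> 'k^'d) \<Rightarrow> 'k^('a \<times> 'b) \<Rightarrow> 'k^('c \<times> 'd)"
  (infixr "\<otimes>\<^sub>m" 75)
  where "f \<otimes>\<^sub>m g = (\<lambda>t. \<Sum>p\<in>UNIV. t $ p *s (f (axis (fst p) 1) \<otimes>\<^sub>v g (axis (snd p) 1)))"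

definition flip :: "'k::field^('a::finite \<times> 'b::finite) \<Rightarrow> 'k^('b \<times> 'a)"
  where "flip t = (\<chi> p. t $ (snd p, fst p))"

definition assocl :: "'k::field^('a::finite \<times> 'b::finite \<times> 'c::finite) \<Rightarrow> 'k^(('a \<times> 'b) \<times> 'c)"
  where "assocl t = (\<chi> p. t $ (fst (fst p), snd (fst p), snd p))"

definition assocr :: "'k::field^(('a::finite \<times> 'b::finite) \<times> 'c::finite) \<Rightarrow> 'k^('a \<times> 'b \<times> 'c)"
  where "assocr t = (\<chi> p. t $ ((fst p, fst (snd p)), snd (snd p)))"

text \<open>The map \<open>1 \<otimes> \<tau> \<otimes> 1\<close> on \<open>(U \<otimes> V) \<otimes> (W \<otimes> X)\<close>.\<close>

definition mid_flip ::
  "'k::field^(('a::finite \<times> 'b::finite) \<times> ('c::finite \<times> 'd::finite)) \<Rightarrow> 'k^(('a \<times> 'c) \<times> ('b \<times> 'd))"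
  where "mid_flip = assocl \<circ> (id \<otimes>\<^sub>m (assocr \<circ> (flip \<otimes>\<^sub>m id) \<circ> assocl)) \<circ> assocr"

definition lin_ext :: "('a \<Rightarrow> 'k::field^'b) \<Rightarrow> 'k^'a \<Rightarrow> 'k^'b"
  where "lin_ext b v = (\<Sum>i\<in>UNIV. v $ i *s b i)"

abbreviation klinear :: "('k::field^'a \<Rightarrow> 'k^'b) \<Rightarrow> bool"
  where "klinear f \<equiv> Vector_Spaces.linear (*s) (*s) f"

locale hopf_algebra =
  fixes mu :: "'k::field^('b \<times> 'b) \<Rightarrow> 'k^'b"
    and one :: "'k^'b"
    and Delta :: "'k^'b \<Rightarrow> 'k^('b \<times> 'b)"
    and eps :: "'k^'b \<Rightarrow> 'k"
    and S :: "'k^'b \<Rightarrow> 'k^'b"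
  assumes linear_mu: "klinear mu"
    and linear_Delta: "klinear Delta"
    and linear_eps: "Vector_Spaces.linear (*s) (*) eps"
    and linear_S: "klinear S"
    and assoc: "mu \<circ> (mu \<otimes>\<^sub>m id) = mu \<circ> (id \<otimes>\<^sub>m mu) \<circ> assocr"
    and unit_left: "mu (one \<otimes>\<^sub>v v) = v"
    and unit_right: "mu (v \<otimes>\<^sub>v one) = v"
    and coassoc: "assocr \<circ> (Delta \<otimes>\<^sub>m id) \<circ> Delta = (id \<otimes>\<^sub>m Delta) \<circ> Delta"
    and counit_left:
      "(\<Sum>p\<in>UNIV. (Delta v $ p * eps (axis (fst p) 1)) *s axis (snd p) 1) = v"
    and counit_right:
      "(\<Sum>p\<in>UNIV. (Delta v $ p * eps (axis (snd p) 1)) *s axis (fst p) 1) = v"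
    and Delta_mult: "Delta \<circ> mu = (mu \<otimes>\<^sub>m mu) \<circ> mid_flip \<circ> (Delta \<otimes>\<^sub>m Delta)"
    and Delta_one: "Delta one = one \<otimes>\<^sub>v one"
    and eps_mult: "eps (mu (u \<otimes>\<^sub>v v)) = eps u * eps v"
    and eps_one: "eps one = 1"
    and antipode_left: "mu ((S \<otimes>\<^sub>m id) (Delta v)) = eps v *s one"
    and antipode_right: "mu ((id \<otimes>\<^sub>m S) (Delta v)) = eps v *s one"


section \<open>Adjoint cohomology in degree two\<close>

definition ad_map ::
  "('k::field^('b \<times> 'b) \<Rightarrow> 'k^'b) \<Rightarrow> ('k^'b \<Rightarrow> 'k^('b \<times> 'b)) \<Rightarrow> ('k^'b \<Rightarrow> 'k^'b)
    \<Rightarrow> 'k^('b \<times> 'b) \<Rightarrow> 'k^'b"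
  \<comment> \<open>\<open>a \<otimes> y \<mapsto> a \<otimes> (y\<^sub>1 \<otimes> y\<^sub>2) \<mapsto> (y\<^sub>1 \<otimes> a) \<otimes> y\<^sub>2 \<mapsto> S(y\<^sub>1) a y\<^sub>2\<close>\<close>
  where "ad_map mu Delta S =
    mu \<circ> ((mu \<circ> (S \<otimes>\<^sub>m id)) \<otimes>\<^sub>m id) \<circ> (flip \<otimes>\<^sub>m id) \<circ> assocl \<circ> (id \<otimes>\<^sub>m Delta)"

definition C1_ad ::
  "('k::field^('b \<times> 'b) \<Rightarrow> 'k^'b) \<Rightarrow> ('k^'b \<Rightarrow> 'k^('b \<times> 'b)) \<Rightarrow> ('k^'b \<Rightarrow> 'k^'b) set"
  where "C1_ad mu Delta =
    {f. klinear f \<and>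
        f \<circ> mu = (mu \<circ> (f \<otimes>\<^sub>m id)) + (mu \<circ> (id \<otimes>\<^sub>m f)) \<and>
        Delta \<circ> f = ((f \<otimes>\<^sub>m id) \<circ> Delta) + ((id \<otimes>\<^sub>m f) \<circ> Delta)}"

definition C2_ad :: "('k::field^('b \<times> 'b) \<Rightarrow> 'k^'b) set"
  where "C2_ad = {\<phi>. klinear \<phi>}"

definition D1_ad ::
  "('k::field^('b \<times> 'b) \<Rightarrow> 'k^'b) \<Rightarrow> ('k^'b \<Rightarrow> 'k^('b \<times> 'b)) \<Rightarrow> ('k^'b \<Rightarrow> 'k^'b)
    \<Rightarrow> ('k^'b \<Rightarrow> 'k^'b) \<Rightarrow> ('k^('b \<times> 'b) \<Rightarrow> 'k^'b)"
  where "D1_ad mu Delta S f =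
    (let ad = ad_map mu Delta S in (ad \<circ> (id \<otimes>\<^sub>m f)) - (f \<circ> ad) + (ad \<circ> (f \<otimes>\<^sub>m id)))"

definition d21_ad ::
  "('k::field^('b \<times> 'b) \<Rightarrow> 'k^'b) \<Rightarrow> ('k^'b \<Rightarrow> 'k^('b \<times> 'b)) \<Rightarrow> ('k^'b \<Rightarrow> 'k^'b)
    \<Rightarrow> ('k^('b \<times> 'b) \<Rightarrow> 'k^'b) \<Rightarrow> ('k^(('b \<times> 'b) \<times> 'b) \<Rightarrow> 'k^'b)"
  where "d21_ad mu Delta S \<phi> =
    (let ad = ad_map mu Delta S in
      (ad \<circ> (\<phi> \<otimes>\<^sub>m id)) + (\<phi> \<circ> (ad \<otimes>\<^sub>m id)) - (\<phi> \<circ> (id \<otimes>\<^sub>m mu) \<circ> assocr))"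

definition d22_ad ::
  "('k::field^('b \<times> 'b) \<Rightarrow> 'k^'b) \<Rightarrow> ('k^'b \<Rightarrow> 'k^('b \<times> 'b))
    \<Rightarrow> ('k^('b \<times> 'b) \<Rightarrow> 'k^'b) \<Rightarrow> ('k^('b \<times> 'b) \<Rightarrow> 'k^('b \<times> 'b))"
  where "d22_ad mu Delta \<phi> =
    ((\<phi> \<otimes>\<^sub>m mu) \<circ> mid_flip \<circ> (Delta \<otimes>\<^sub>m Delta))
    - ((id \<otimes>\<^sub>m mu) \<circ> assocr \<circ> (flip \<otimes>\<^sub>m id) \<circ> assocl \<circ> (id \<otimes>\<^sub>m Delta)
        \<circ> (id \<otimes>\<^sub>m \<phi>) \<circ> assocr \<circ> (flip \<otimes>\<^sub>m id) \<circ> assocl \<circ> (id \<otimes>\<^sub>m Delta))"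

definition D2_ad ::
  "('k::field^('b \<times> 'b) \<Rightarrow> 'k^'b) \<Rightarrow> ('k^'b \<Rightarrow> 'k^('b \<times> 'b)) \<Rightarrow> ('k^'b \<Rightarrow> 'k^'b)
    \<Rightarrow> ('k^('b \<times> 'b) \<Rightarrow> 'k^'b)
    \<Rightarrow> ('k^(('b \<times> 'b) \<times> 'b) \<Rightarrow> 'k^'b) \<times> ('k^('b \<times> 'b) \<Rightarrow> 'k^('b \<times> 'b))"
  where "D2_ad mu Delta S \<phi> = (d21_ad mu Delta S \<phi>, d22_ad mu Delta \<phi>)"

definition Z2_ad ::
  "('k::field^('b \<times> 'b) \<Rightarrow> 'k^'b) \<Rightarrow> ('k^'b \<Rightarrow> 'k^('b \<times> 'b)) \<Rightarrow> ('k^'b \<Rightarrow> 'k^'b)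
    \<Rightarrow> ('k^('b \<times> 'b) \<Rightarrow> 'k^'b) set"
  where "Z2_ad mu Delta S = {\<phi> \<in> C2_ad. D2_ad mu Delta S \<phi> = 0}"

definition B2_ad ::
  "('k::field^('b \<times> 'b) \<Rightarrow> 'k^'b) \<Rightarrow> ('k^'b \<Rightarrow> 'k^('b \<times> 'b)) \<Rightarrow> ('k^'b \<Rightarrow> 'k^'b)
    \<Rightarrow> ('k^('b \<times> 'b) \<Rightarrow> 'k^'b) set"
  where "B2_ad mu Delta S = D1_ad mu Delta S ` C1_ad mu Delta"

text \<open>
  The elements of \<open>H\<^sup>2\<close> are the cosets \<open>\<phi> + B2\<close> of 2-cocycles. Cosets are added as sets; the
  scalar multiple of a coset is the coset of a scalar multiple of any representative (adding
  \<open>B2\<close> once more matters only for the scalar \<open>0\<close>).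
\<close>

definition H2_ad ::
  "('k::field^('b \<times> 'b) \<Rightarrow> 'k^'b) \<Rightarrow> ('k^'b \<Rightarrow> 'k^('b \<times> 'b)) \<Rightarrow> ('k^'b \<Rightarrow> 'k^'b)
    \<Rightarrow> ('k^('b \<times> 'b) \<Rightarrow> 'k^'b) set set"
  where "H2_ad mu Delta S = (\<lambda>\<phi>. {\<phi>} + B2_ad mu Delta S) ` Z2_ad mu Delta S"

definition H2_scale ::
  "('k::field^('b \<times> 'b) \<Rightarrow> 'k^'b) \<Rightarrow> ('k^'b \<Rightarrow> 'k^('b \<times> 'b)) \<Rightarrow> ('k^'b \<Rightarrow> 'k^'b)
    \<Rightarrow> 'k \<Rightarrow> ('k^('b \<times> 'b) \<Rightarrow> 'k^'b) set \<Rightarrow> ('k^('b \<times> 'b) \<Rightarrow> 'k^'b) set"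
  where "H2_scale mu Delta S c X = (\<lambda>\<phi> t. c *s \<phi> t) ` X + B2_ad mu Delta S"


lemma klinearI:
  assumes "\<And>u v. f (u + v) = f u + f v" "\<And>c v. f (c *s v) = c *s f v"
  shows "klinear f"
  using assms by (intro Vector_Spaces.linear_iff[THEN iffD2]) (simp add: vec.vector_space_axioms)

lemma klinear_simps:
  assumes "klinear f"
  shows "f (u + v) = f u + f v" "f (c *s v) = c *s f v" "f (- v) = - f v"
    "f (u - v) = f u - f v" "f 0 = 0"
    "f (sum w A) = (\<Sum>i\<in>A. f (w i))"
proof -
  interpret f: Vector_Spaces.linear "(*s)" "(*s)" f by fact
  show "f (u + v) = f u + f v" by (rule f.add)
  show "f (c *s v) = c *s f v" by (rule f.scale)
  show "f (- v) = - f v" by (rule f.neg)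
  show "f (u - v) = f u - f v" by (rule f.diff)
  show "f 0 = 0" by (rule f.zero)
  show "f (sum w A) = (\<Sum>i\<in>A. f (w i))" by (rule f.sum)
qed

lemma klinear_compose: "klinear f \<Longrightarrow> klinear g \<Longrightarrow> klinear (g \<circ> f)"
  by (rule Vector_Spaces.linear_compose)

lemma klinear_id: "klinear id"
  by (rule klinearI) auto

lemma tensor_simps [simp]:
  "(u + v) \<otimes>\<^sub>v w = u \<otimes>\<^sub>v w + v \<otimes>\<^sub>v w" "w \<otimes>\<^sub>v (u + v) = w \<otimes>\<^sub>v u + w \<otimes>\<^sub>v v"
  "(- v) \<otimes>\<^sub>v w = - (v \<otimes>\<^sub>v w)" "w \<otimes>\<^sub>v (- v) = - (w \<otimes>\<^sub>v v)"
  "0 \<otimes>\<^sub>v w = 0" "w \<otimes>\<^sub>v 0 = 0"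
  "(c *s v) \<otimes>\<^sub>v w = c *s (v \<otimes>\<^sub>v w)" "w \<otimes>\<^sub>v (c *s v) = c *s (w \<otimes>\<^sub>v v)"
  by (simp_all add: tensor_def vec_eq_iff algebra_simps)

lemma tensor_axis: "axis i 1 \<otimes>\<^sub>v axis j 1 = axis (i, j) (1::'k::field)"
  by (auto simp: tensor_def vec_eq_iff axis_def)

lemma vec_expand: "(\<Sum>i\<in>UNIV. v $ i *s axis i 1) = (v :: 'k::field^'a)"
  by (rule basis_expansion)

lemma klinear_lin_ext: "klinear (lin_ext b)"
  by (rule klinearI)
    (simp_all add: lin_ext_def vec.scale_left_distrib sum.distrib vec.scale_sum_right)

lemma lin_ext_axis: "lin_ext b (axis i 1) = (b i :: 'k::field^'b)"
proof -
  have "(if j = i then 1 else (0::'k)) *s b j = (if j = i then b j else 0)" for j by simp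
  then show ?thesis by (simp add: lin_ext_def axis_def)
qed

lemma klinear_eq_lin_ext: "klinear f \<Longrightarrow> f = lin_ext (\<lambda>i. f (axis i 1))"
proof
  fix v assume "klinear f"
  then have "f (\<Sum>i\<in>UNIV. v $ i *s axis i 1) = lin_ext (\<lambda>i. f (axis i 1)) v"
    by (simp add: klinear_simps lin_ext_def)
  then show "f v = lin_ext (\<lambda>i. f (axis i 1)) v" by (simp only: vec_expand)
qed

lemma klinear_eqI:
  assumes "klinear f" "klinear h" "\<And>i. f (axis i 1) = h (axis i 1)"
  shows "f = h"
  using klinear_eq_lin_ext[OF assms(1)] klinear_eq_lin_ext[OF assms(2)] assms(3) by simp

lemma klinear_tensor_eqI:
  assumes "klinear f" "klinear h" "\<And>i j. f (axis i 1 \<otimes>\<^sub>v axis j 1) = h (axis i 1 \<otimes>\<^sub>v axis j 1)"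
  shows "f = h"
  using assms by (intro klinear_eqI) (auto simp: tensor_axis)

lemma tensor_map_lin_ext:
  "f \<otimes>\<^sub>m g = lin_ext (\<lambda>p. f (axis (fst p) 1) \<otimes>\<^sub>v g (axis (snd p) 1))"
  by (simp add: tensor_map_def lin_ext_def fun_eq_iff)

lemma klinear_tensor_map: "klinear (f \<otimes>\<^sub>m g)"
  by (simp add: tensor_map_lin_ext klinear_lin_ext)

lemma tensor_map_tensor:
  assumes "klinear f" "klinear g"
  shows "(f \<otimes>\<^sub>m g) (u \<otimes>\<^sub>v v) = f u \<otimes>\<^sub>v g v"
proof -
  have "klinear (\<lambda>u. (f \<otimes>\<^sub>m g) (u \<otimes>\<^sub>v v))" "klinear (\<lambda>u. f u \<otimes>\<^sub>v g v)"
    "klinear (\<lambda>v. (f \<otimes>\<^sub>m g) (u \<otimes>\<^sub>v v))" "klinear (\<lambda>v. f u \<otimes>\<^sub>v g v)" for u v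
    by (rule klinearI; simp add: klinear_simps[OF klinear_tensor_map] klinear_simps[OF assms(1)]
        klinear_simps[OF assms(2)])+
  note lin = this
  have "(f \<otimes>\<^sub>m g) (axis i 1 \<otimes>\<^sub>v axis j 1) = f (axis i 1) \<otimes>\<^sub>v g (axis j 1)" for i j
    by (simp add: tensor_axis) (simp add: tensor_map_lin_ext lin_ext_axis)
  then have "(\<lambda>v. (f \<otimes>\<^sub>m g) (axis i 1 \<otimes>\<^sub>v v)) = (\<lambda>v. f (axis i 1) \<otimes>\<^sub>v g v)" for i
    by (intro klinear_eqI lin) simp
  then have "(\<lambda>u. (f \<otimes>\<^sub>m g) (u \<otimes>\<^sub>v v)) = (\<lambda>u. f u \<otimes>\<^sub>v g v)"
    by (intro klinear_eqI lin) (simp add: fun_eq_iff)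
  then show ?thesis by (simp add: fun_eq_iff)
qed

lemma klinear_reindex: "klinear flip" "klinear assocl" "klinear assocr"
  by (rule klinearI; simp add: flip_def assocl_def assocr_def vec_eq_iff)+

lemma reindex_tensor [simp]:
  "flip (u \<otimes>\<^sub>v v) = v \<otimes>\<^sub>v u"
  "assocl (u \<otimes>\<^sub>v v \<otimes>\<^sub>v w) = (u \<otimes>\<^sub>v v) \<otimes>\<^sub>v w"
  "assocr ((u \<otimes>\<^sub>v v) \<otimes>\<^sub>v w) = u \<otimes>\<^sub>v v \<otimes>\<^sub>v w"
  by (simp_all add: flip_def assocl_def assocr_def tensor_def vec_eq_iff ac_simps)

lemma klinear_mid_flip: "klinear mid_flip"
  unfolding mid_flip_def by (intro klinear_compose klinear_reindex klinear_tensor_map)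

lemma mid_flip_tensor [simp]:
  "mid_flip ((u \<otimes>\<^sub>v v) \<otimes>\<^sub>v (w \<otimes>\<^sub>v z)) = (u \<otimes>\<^sub>v w) \<otimes>\<^sub>v (v \<otimes>\<^sub>v z)"
  by (simp add: mid_flip_def tensor_map_tensor klinear_id klinear_compose klinear_reindex
      klinear_tensor_map)

text \<open>The operations on cosets are the usual ones of a quotient space.\<close>

lemma tensor_map_add_scale:
  "(f + g) \<otimes>\<^sub>m h = (f \<otimes>\<^sub>m h) + (g \<otimes>\<^sub>m h)" "h \<otimes>\<^sub>m (f + g) = (h \<otimes>\<^sub>m f) + (h \<otimes>\<^sub>m g)"
  "(\<lambda>v. c *s f v) \<otimes>\<^sub>m h = (\<lambda>t. c *s (f \<otimes>\<^sub>m h) t)" "h \<otimes>\<^sub>m (\<lambda>v. c *s f v) = (\<lambda>t. c *s (h \<otimes>\<^sub>m f) t)"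
  by (simp_all add: tensor_map_def fun_eq_iff vec.scale_right_distrib sum.distrib
      vec.scale_sum_right mult.commute)

lemma klinear_ad_map: "klinear mu \<Longrightarrow> klinear (ad_map mu Delta S)"
  unfolding ad_map_def by (intro klinear_compose klinear_reindex klinear_tensor_map)

lemma
  assumes mu: "klinear mu" and Delta: "klinear Delta"
  shows C1_ad_add: "f \<in> C1_ad mu Delta \<Longrightarrow> g \<in> C1_ad mu Delta \<Longrightarrow> f + g \<in> C1_ad mu Delta"
    and C1_ad_scale: "f \<in> C1_ad mu Delta \<Longrightarrow> (\<lambda>v. c *s f v) \<in> C1_ad mu Delta"
  by (auto simp: C1_ad_def fun_eq_iff tensor_map_add_scale klinear_simps[OF mu]
      klinear_simps[OF Delta] klinear_simps vec.scale_right_distrib algebra_simps intro!: klinearI)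

lemma
  assumes mu: "klinear mu"
  shows D1_ad_add: "D1_ad mu Delta S (f + g) = D1_ad mu Delta S f + D1_ad mu Delta S g"
    and D1_ad_scale: "D1_ad mu Delta S (\<lambda>v. c *s f v) = (\<lambda>t. c *s D1_ad mu Delta S f t)"
  by (auto simp: D1_ad_def Let_def fun_eq_iff tensor_map_add_scale
      klinear_simps[OF klinear_ad_map[OF mu]] vec.scale_right_distrib vec.scale_right_diff_distrib)

lemma
  assumes mu: "klinear mu" and Delta: "klinear Delta"
  shows B2_ad_add: "\<phi> \<in> B2_ad mu Delta S \<Longrightarrow> \<psi> \<in> B2_ad mu Delta S \<Longrightarrow> \<phi> + \<psi> \<in> B2_ad mu Delta S"
    and B2_ad_scale: "\<phi> \<in> B2_ad mu Delta S \<Longrightarrow> (\<lambda>t. c *s \<phi> t) \<in> B2_ad mu Delta S"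
    and B2_ad_zero: "0 \<in> B2_ad mu Delta S"
proof -
  show "\<phi> + \<psi> \<in> B2_ad mu Delta S" if "\<phi> \<in> B2_ad mu Delta S" "\<psi> \<in> B2_ad mu Delta S"
    using that by (auto simp: B2_ad_def simp flip: D1_ad_add[OF mu] intro!: imageI C1_ad_add mu Delta)
  show scale: "(\<lambda>t. c *s \<phi> t) \<in> B2_ad mu Delta S" if "\<phi> \<in> B2_ad mu Delta S" for c \<phi>
    using that by (auto simp: B2_ad_def simp flip: D1_ad_scale[OF mu] intro!: imageI C1_ad_scale mu Delta)
  have "(\<lambda>v. 0) \<in> C1_ad mu Delta"
    by (auto simp: C1_ad_def fun_eq_iff tensor_map_def klinear_simps[OF mu]
        klinear_simps[OF Delta] intro!: klinearI)
  then have "D1_ad mu Delta S (\<lambda>v. 0) \<in> B2_ad mu Delta S" by (simp add: B2_ad_def)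
  from scale[OF this, of 0] show "0 \<in> B2_ad mu Delta S" by (simp add: zero_fun_def)
qed

lemma
  fixes \<phi> \<psi> :: "'k::field^('b \<times> 'b) \<Rightarrow> 'k^'b"
  assumes mu: "klinear mu" and Delta: "klinear Delta"
  shows H2_add_coset: "({\<phi>} + B2_ad mu Delta S) + ({\<psi>} + B2_ad mu Delta S)
      = {\<phi> + \<psi>} + B2_ad mu Delta S"
    and H2_scale_coset: "H2_scale mu Delta S c ({\<phi>} + B2_ad mu Delta S)
      = {\<lambda>t. c *s \<phi> t} + B2_ad mu Delta S"
proof -
  let ?B = "B2_ad mu Delta S"
  have BB: "?B + ?B = ?B"
    using B2_ad_add[OF mu Delta] B2_ad_zero[OF mu Delta]
    by (auto simp: set_plus_def) (metis add.right_neutral)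
  have "({\<phi>} + ?B) + ({\<psi>} + ?B) = ({\<phi>} + {\<psi>}) + (?B + ?B)"
    by (simp add: ac_simps)
  also have "{\<phi>} + {\<psi>} = {\<phi> + \<psi>}" by (simp add: set_plus_def)
  finally show "({\<phi>} + ?B) + ({\<psi>} + ?B) = {\<phi> + \<psi>} + ?B" by (simp only: BB)
  let ?cB = "(\<lambda>\<theta> t. c *s \<theta> t) ` ?B"
  have "?cB \<subseteq> ?B" using B2_ad_scale[OF mu Delta] by auto
  then have "?cB + ?B \<subseteq> ?B" using set_plus_mono2[of ?cB ?B ?B ?B] BB by simp
  moreover have "0 \<in> ?cB"
    using B2_ad_zero[OF mu Delta] by (auto simp: image_iff fun_eq_iff intro!: bexI[of _ 0])
  then have "?B \<subseteq> ?cB + ?B" by (metis set_zero_plus2)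
  ultimately have cB: "?cB + ?B = ?B" by simp
  have im: "{\<theta>} + A = (\<lambda>\<beta>. \<theta> + \<beta>) ` A" for \<theta> :: "'k^('b \<times> 'b) \<Rightarrow> 'k^'b" and A
    by (auto simp: set_plus_def)
  have "(\<lambda>\<theta> t. c *s \<theta> t) ` ({\<phi>} + ?B) = {\<lambda>t. c *s \<phi> t} + ?cB"
    by (simp add: im image_image vec.scale_right_distrib plus_fun_def)
  then show "H2_scale mu Delta S c ({\<phi>} + ?B) = {\<lambda>t. c *s \<phi> t} + ?B"
    by (simp add: H2_scale_def add.assoc cB)
qed


section \<open>The bosonization of the superline\<close>

text \<open>Indices of the basis \<open>1, g, x, gx\<close>.\<close>

datatype sl_index = I1 | Ig | Ix | Igx

instance sl_index :: finite
proof
  have "(UNIV :: sl_index set) = {I1, Ig, Ix, Igx}"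
    using sl_index.exhaust by auto
  then show "finite (UNIV :: sl_index set)" by (metis finite.simps)
qed

definition sl_one :: "'k::field^sl_index" where "sl_one = axis I1 1"
definition sl_g :: "'k::field^sl_index" where "sl_g = axis Ig 1"
definition sl_x :: "'k::field^sl_index" where "sl_x = axis Ix 1"
definition sl_gx :: "'k::field^sl_index" where "sl_gx = axis Igx 1"

fun sl_table :: "sl_index \<Rightarrow> sl_index \<Rightarrow> 'k::field^sl_index" where
  "sl_table I1 I1 = sl_one" | "sl_table I1 Ig = sl_g"
| "sl_table I1 Ix = sl_x" | "sl_table I1 Igx = sl_gx"
| "sl_table Ig I1 = sl_g" | "sl_table Ig Ig = sl_one"
| "sl_table Ig Ix = sl_gx" | "sl_table Ig Igx = sl_x"
| "sl_table Ix I1 = sl_x" | "sl_table Ix Ig = - sl_gx"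
| "sl_table Ix Ix = 0" | "sl_table Ix Igx = 0"
| "sl_table Igx I1 = sl_gx" | "sl_table Igx Ig = - sl_x"
| "sl_table Igx Ix = 0" | "sl_table Igx Igx = 0"

definition sl_mu :: "'k::field^(sl_index \<times> sl_index) \<Rightarrow> 'k^sl_index"
  where "sl_mu = lin_ext (\<lambda>p. sl_table (fst p) (snd p))"

text \<open>
  On \<open>gx\<close> the comultiplication is \<open>\<Delta>(g)\<Delta>(x)\<close>, the counit \<open>\<epsilon>(g)\<epsilon>(x) = 0\<close> and the antipode
  \<open>S(x)S(g) = (-gx)g = x\<close>.
\<close>

definition sl_Delta :: "'k::field^sl_index \<Rightarrow> 'k^(sl_index \<times> sl_index)"
  where "sl_Delta = lin_ext (\<lambda>i. case i of
      I1 \<Rightarrow> sl_one \<otimes>\<^sub>v sl_one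
    | Ig \<Rightarrow> sl_g \<otimes>\<^sub>v sl_g
    | Ix \<Rightarrow> sl_x \<otimes>\<^sub>v sl_one + sl_g \<otimes>\<^sub>v sl_x
    | Igx \<Rightarrow> sl_gx \<otimes>\<^sub>v sl_g + sl_one \<otimes>\<^sub>v sl_gx)"

definition sl_eps :: "'k::field^sl_index \<Rightarrow> 'k"
  where "sl_eps v = v $ I1 + v $ Ig"

definition sl_S :: "'k::field^sl_index \<Rightarrow> 'k^sl_index"
  where "sl_S = lin_ext (\<lambda>i. case i of
      I1 \<Rightarrow> sl_one | Ig \<Rightarrow> sl_g | Ix \<Rightarrow> - sl_gx | Igx \<Rightarrow> sl_x)"

text \<open>
  The facts below confirm that this is the intended Hopf algebra: it satisfies the Hopf algebra
  axioms and the defining relations, the structure maps have the prescribed values on the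
  generators, and it has the universal property of the algebra presented by \<open>g, x\<close> subject to
  \<open>x\<^sup>2 = 0\<close>, \<open>g\<^sup>2 = 1\<close>, \<open>xg = -gx\<close>.
\<close>

lemma klinear_sl: "klinear sl_mu" "klinear sl_Delta" "klinear sl_S"
  by (simp_all add: sl_mu_def sl_Delta_def sl_S_def klinear_lin_ext)

lemma UNIV_sl_index: "(UNIV :: sl_index set) = {I1, Ig, Ix, Igx}"
  using sl_index.exhaust by auto

lemma sl_axis: "axis I1 1 = sl_one" "axis Ig 1 = sl_g" "axis Ix 1 = sl_x" "axis Igx 1 = sl_gx"
  by (simp_all add: sl_one_def sl_g_def sl_x_def sl_gx_def)

lemma sl_mu_axis: "sl_mu (axis i 1 \<otimes>\<^sub>v axis j 1) = sl_table i j"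
  by (simp add: sl_mu_def tensor_axis lin_ext_axis)

lemma sl_mu_simps [simp]:
  "sl_mu (sl_one \<otimes>\<^sub>v sl_one) = sl_one" "sl_mu (sl_one \<otimes>\<^sub>v sl_g) = sl_g"
  "sl_mu (sl_one \<otimes>\<^sub>v sl_x) = sl_x" "sl_mu (sl_one \<otimes>\<^sub>v sl_gx) = sl_gx"
  "sl_mu (sl_g \<otimes>\<^sub>v sl_one) = sl_g" "sl_mu (sl_g \<otimes>\<^sub>v sl_g) = sl_one"
  "sl_mu (sl_g \<otimes>\<^sub>v sl_x) = sl_gx" "sl_mu (sl_g \<otimes>\<^sub>v sl_gx) = sl_x"
  "sl_mu (sl_x \<otimes>\<^sub>v sl_one) = sl_x" "sl_mu (sl_x \<otimes>\<^sub>v sl_g) = - sl_gx"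
  "sl_mu (sl_x \<otimes>\<^sub>v sl_x) = 0" "sl_mu (sl_x \<otimes>\<^sub>v sl_gx) = 0"
  "sl_mu (sl_gx \<otimes>\<^sub>v sl_one) = sl_gx" "sl_mu (sl_gx \<otimes>\<^sub>v sl_g) = - sl_x"
  "sl_mu (sl_gx \<otimes>\<^sub>v sl_x) = 0" "sl_mu (sl_gx \<otimes>\<^sub>v sl_gx) = 0"
  by (simp_all add: sl_mu_axis flip: sl_axis)

lemma sl_Delta_simps [simp]:
  "sl_Delta sl_one = sl_one \<otimes>\<^sub>v sl_one"
  "sl_Delta sl_g = sl_g \<otimes>\<^sub>v sl_g"
  "sl_Delta sl_x = sl_x \<otimes>\<^sub>v sl_one + sl_g \<otimes>\<^sub>v sl_x"
  "sl_Delta sl_gx = sl_gx \<otimes>\<^sub>v sl_g + sl_one \<otimes>\<^sub>v sl_gx"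
  by (simp_all add: sl_Delta_def lin_ext_axis flip: sl_axis)

lemma sl_S_simps [simp]:
  "sl_S sl_one = sl_one" "sl_S sl_g = sl_g" "sl_S sl_x = - sl_gx" "sl_S sl_gx = sl_x"
  by (simp_all add: sl_S_def lin_ext_axis flip: sl_axis)

lemma sl_eps_simps [simp]:
  "sl_eps sl_one = 1" "sl_eps sl_g = 1" "sl_eps sl_x = 0" "sl_eps sl_gx = 0"
  by (simp_all add: sl_eps_def axis_def flip: sl_axis)

lemma sl_relations:
  "sl_mu (sl_x \<otimes>\<^sub>v sl_x) = 0"
  "sl_mu (sl_g \<otimes>\<^sub>v sl_g) = sl_one"
  "sl_mu (sl_x \<otimes>\<^sub>v sl_g) = - sl_mu (sl_g \<otimes>\<^sub>v sl_x)"
  by simp_all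

lemmas sl_lin_simps = tensor_map_tensor klinear_id klinear_compose klinear_reindex
  klinear_tensor_map klinear_mid_flip klinear_sl
  klinear_simps[OF klinear_tensor_map] klinear_simps[OF klinear_reindex(1)]
  klinear_simps[OF klinear_reindex(2)] klinear_simps[OF klinear_reindex(3)]
  klinear_simps[OF klinear_mid_flip] klinear_simps[OF klinear_sl(1)]
  klinear_simps[OF klinear_sl(2)] klinear_simps[OF klinear_sl(3)]

lemma linear_sl_eps: "Vector_Spaces.linear (*s) (*) sl_eps"
  by (intro Vector_Spaces.linear_iff[THEN iffD2])
    (simp add: vec.vector_space_axioms vector_space_over_itself.vector_space_axioms
      sl_eps_def algebra_simps)

lemma sl_eps_add: "sl_eps (u + v) = sl_eps u + sl_eps v"
  and sl_eps_scale: "sl_eps (c *s v) = c * sl_eps v"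
  by (simp_all add: sl_eps_def algebra_simps)

lemma sl_expand:
  "v = v $ I1 *s sl_one + v $ Ig *s sl_g + v $ Ix *s sl_x + v $ Igx *s sl_gx"
  using vec_expand[of v] by (simp add: UNIV_sl_index sl_axis add.assoc)

lemma sl_mu_nth:
  "sl_mu (u \<otimes>\<^sub>v v) $ I1 = u $ I1 * v $ I1 + u $ Ig * v $ Ig"
  "sl_mu (u \<otimes>\<^sub>v v) $ Ig = u $ I1 * v $ Ig + u $ Ig * v $ I1"
  "sl_mu (u \<otimes>\<^sub>v v) $ Ix = u $ I1 * v $ Ix + u $ Ig * v $ Igx + u $ Ix * v $ I1 - u $ Igx * v $ Ig"
  "sl_mu (u \<otimes>\<^sub>v v) $ Igx = u $ I1 * v $ Igx + u $ Ig * v $ Ix - u $ Ix * v $ Ig + u $ Igx * v $ I1"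
  by (simp_all add: sl_mu_def lin_ext_def tensor_def UNIV_sl_index sl_one_def sl_g_def sl_x_def
      sl_gx_def axis_def sum.cartesian_product[symmetric] flip: UNIV_Times_UNIV)

lemma klinear_sl_eqI:
  assumes "klinear f" "klinear h"
    "f sl_one = h sl_one" "f sl_g = h sl_g" "f sl_x = h sl_x" "f sl_gx = h sl_gx"
  shows "f = h"
proof (rule klinear_eqI[OF assms(1,2)])
  show "f (axis i 1) = h (axis i 1)" for i
    by (cases i) (simp_all add: sl_axis assms)
qed

lemma klinear_sl2_eqI:
  assumes "klinear f" "klinear h"
    and "\<And>u v. u \<in> {sl_one, sl_g, sl_x, sl_gx} \<Longrightarrow> v \<in> {sl_one, sl_g, sl_x, sl_gx}
      \<Longrightarrow> f (u \<otimes>\<^sub>v v) = h (u \<otimes>\<^sub>v v)"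
  shows "f = h"
proof (rule klinear_tensor_eqI[OF assms(1,2)])
  show "f (axis i 1 \<otimes>\<^sub>v axis j 1) = h (axis i 1 \<otimes>\<^sub>v axis j 1)" for i j
    by (rule assms(3); cases i; cases j) (simp_all add: sl_axis)
qed

lemma klinear_sl3_eqI:
  assumes "klinear f" "klinear h"
    and "\<And>u v w. u \<in> {sl_one, sl_g, sl_x, sl_gx} \<Longrightarrow> v \<in> {sl_one, sl_g, sl_x, sl_gx}
      \<Longrightarrow> w \<in> {sl_one, sl_g, sl_x, sl_gx} \<Longrightarrow> f ((u \<otimes>\<^sub>v v) \<otimes>\<^sub>v w) = h ((u \<otimes>\<^sub>v v) \<otimes>\<^sub>v w)"
  shows "f = h"
proof (rule klinear_tensor_eqI[OF assms(1,2)])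
  show "f (axis p 1 \<otimes>\<^sub>v axis l 1) = h (axis p 1 \<otimes>\<^sub>v axis l 1)" for p l
  proof -
    obtain i j where "p = (i, j)" by force
    moreover have "f ((axis i 1 \<otimes>\<^sub>v axis j 1) \<otimes>\<^sub>v axis l 1)
        = h ((axis i 1 \<otimes>\<^sub>v axis j 1) \<otimes>\<^sub>v axis l 1)"
      by (rule assms(3); cases i; cases j; cases l) (simp_all add: sl_axis)
    ultimately show ?thesis by (simp add: tensor_axis)
  qed
qed

theorem hopf_algebra_superline: "hopf_algebra sl_mu (sl_one :: 'k::field^sl_index) sl_Delta sl_eps sl_S"
proof (rule hopf_algebra.intro)
  show "klinear sl_mu" "klinear sl_Delta" "klinear sl_S" by (rule klinear_sl)+
  show "Vector_Spaces.linear (*s) (*) sl_eps" by (rule linear_sl_eps)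
  show "sl_mu \<circ> (sl_mu \<otimes>\<^sub>m id) = sl_mu \<circ> (id \<otimes>\<^sub>m sl_mu) \<circ> assocr"
    by (rule klinear_sl3_eqI; (intro klinear_compose klinear_sl klinear_tensor_map klinear_reindex)?)
      (auto simp: sl_lin_simps)
  show "sl_mu (sl_one \<otimes>\<^sub>v v) = v" for v
  proof -
    have "(\<lambda>v. sl_mu (sl_one \<otimes>\<^sub>v v)) = id"
      by (rule klinear_sl_eqI; (rule klinearI)?) (simp_all add: sl_lin_simps)
    then show ?thesis by (metis id_apply)
  qed
  show "sl_mu (v \<otimes>\<^sub>v sl_one) = v" for v
  proof -
    have "(\<lambda>v. sl_mu (v \<otimes>\<^sub>v sl_one)) = id"
      by (rule klinear_sl_eqI; (rule klinearI)?) (simp_all add: sl_lin_simps)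
    then show ?thesis by (metis id_apply)
  qed
  show "assocr \<circ> (sl_Delta \<otimes>\<^sub>m id) \<circ> sl_Delta = (id \<otimes>\<^sub>m sl_Delta) \<circ> sl_Delta"
    by (rule klinear_sl_eqI;
        (intro klinear_compose klinear_sl klinear_tensor_map klinear_reindex)?)
      (auto simp: sl_lin_simps)
  define cl where "cl t = (\<Sum>p\<in>UNIV. (t $ p * sl_eps (axis (fst p) 1)) *s axis (snd p) 1)"
    for t :: "'k^(sl_index \<times> sl_index)"
  define cr where "cr t = (\<Sum>p\<in>UNIV. (t $ p * sl_eps (axis (snd p) 1)) *s axis (fst p) 1)"
    for t :: "'k^(sl_index \<times> sl_index)"
  have cl: "cl = lin_ext (\<lambda>p. sl_eps (axis (fst p) 1) *s axis (snd p) 1)"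
    and cr: "cr = lin_ext (\<lambda>p. sl_eps (axis (snd p) 1) *s axis (fst p) 1)"
    by (simp_all add: cl_def cr_def lin_ext_def fun_eq_iff)
  have lin_c: "klinear cl" "klinear cr"
    by (simp_all add: cl cr klinear_lin_ext)
  have cl_tensor: "cl (axis i 1 \<otimes>\<^sub>v axis j 1) = sl_eps (axis i 1) *s axis j 1"
    and cr_tensor: "cr (axis i 1 \<otimes>\<^sub>v axis j 1) = sl_eps (axis j 1) *s axis i 1" for i j
    by (simp_all add: cl cr tensor_axis lin_ext_axis)
  have "cl \<circ> sl_Delta = id"
    by (rule klinear_sl_eqI; (intro klinear_compose klinear_sl lin_c klinear_id)?)
      (simp_all add: sl_lin_simps klinear_simps[OF lin_c(1)]  cl_tensor[of I1 I1, unfolded sl_axis] cl_tensor[of Ig Ig, unfolded sl_axis]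
        cl_tensor[of Ix I1, unfolded sl_axis] cl_tensor[of Ig Ix, unfolded sl_axis]
        cl_tensor[of Igx Ig, unfolded sl_axis] cl_tensor[of I1 Igx, unfolded sl_axis])
  then have "cl (sl_Delta v) = v" for v by (simp add: fun_eq_iff)
  then show "(\<Sum>p\<in>UNIV. (sl_Delta v $ p * sl_eps (axis (fst p) 1)) *s axis (snd p) 1) = v"
    for v :: "'k^sl_index" by (simp only: cl_def)
  have "cr \<circ> sl_Delta = id"
    by (rule klinear_sl_eqI; (intro klinear_compose klinear_sl lin_c klinear_id)?)
      (simp_all add: sl_lin_simps klinear_simps[OF lin_c(2)]
        cr_tensor[of I1 I1, unfolded sl_axis] cr_tensor[of Ig Ig, unfolded sl_axis]
        cr_tensor[of Ix I1, unfolded sl_axis] cr_tensor[of Ig Ix, unfolded sl_axis]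
        cr_tensor[of Igx Ig, unfolded sl_axis] cr_tensor[of I1 Igx, unfolded sl_axis])
  then have "cr (sl_Delta v) = v" for v by (simp add: fun_eq_iff)
  then show "(\<Sum>p\<in>UNIV. (sl_Delta v $ p * sl_eps (axis (snd p) 1)) *s axis (fst p) 1) = v"
    for v :: "'k^sl_index" by (simp only: cr_def)
  show "sl_Delta \<circ> sl_mu = (sl_mu \<otimes>\<^sub>m sl_mu) \<circ> mid_flip \<circ> (sl_Delta \<otimes>\<^sub>m sl_Delta)"
    by (rule klinear_sl2_eqI;
        (intro klinear_compose klinear_sl klinear_tensor_map klinear_mid_flip)?)
      (auto simp: sl_lin_simps)
  show "sl_Delta sl_one = sl_one \<otimes>\<^sub>v sl_one" by simp
  show "sl_eps (sl_mu (u \<otimes>\<^sub>v v)) = sl_eps u * sl_eps v" for u v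
    by (simp add: sl_eps_def sl_mu_nth algebra_simps)
  show "sl_eps sl_one = 1" by simp
  have "sl_mu \<circ> (sl_S \<otimes>\<^sub>m id) \<circ> sl_Delta = (\<lambda>v :: 'k^sl_index. sl_eps v *s sl_one)"
    by (rule klinear_sl_eqI; (intro klinear_compose klinear_sl klinear_tensor_map)?; (rule klinearI)?)
      (simp_all add: sl_lin_simps sl_eps_add sl_eps_scale vec.scale_left_distrib)
  then show "sl_mu ((sl_S \<otimes>\<^sub>m id) (sl_Delta v)) = sl_eps v *s sl_one" for v :: "'k^sl_index"
    by (simp add: fun_eq_iff)
  have "sl_mu \<circ> (id \<otimes>\<^sub>m sl_S) \<circ> sl_Delta = (\<lambda>v :: 'k^sl_index. sl_eps v *s sl_one)"
    by (rule klinear_sl_eqI; (intro klinear_compose klinear_sl klinear_tensor_map)?; (rule klinearI)?)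
      (simp_all add: sl_lin_simps sl_eps_add sl_eps_scale vec.scale_left_distrib)
  then show "sl_mu ((id \<otimes>\<^sub>m sl_S) (sl_Delta v)) = sl_eps v *s sl_one" for v :: "'k^sl_index"
    by (simp add: fun_eq_iff)
qed

theorem superline_presentation:
  fixes s :: "'k::field \<Rightarrow> 'a::ring_1 \<Rightarrow> 'a" and G X :: 'a
  assumes "vector_space s"
    and scale_mult: "\<And>c a b. s c (a * b) = s c a * b" "\<And>c a b. s c (a * b) = a * s c b"
    and rel: "X * X = 0" "G * G = 1" "X * G = - (G * X)"
  shows "\<exists>!f. Vector_Spaces.linear (*s) s f \<and> f sl_one = 1 \<and>
    (\<forall>u v. f (sl_mu (u \<otimes>\<^sub>v v)) = f u * f v) \<and> f sl_g = G \<and> f sl_x = X"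
proof -
  interpret A: vector_space s by fact
  show ?thesis
  proof (rule ex1I)
    let ?f = "\<lambda>v. s (v $ I1) 1 + s (v $ Ig) G + s (v $ Ix) X + s (v $ Igx) (G * X)"
    have scale: "s c a * b = s c (a * b)" "a * s c b = s c (a * b)" for c a b
      using scale_mult by metis+
    have rel': "G * (G * a) = a" "X * (X * a) = 0" "X * (G * a) = - (G * (X * a))" for a
      using rel by (metis mult.assoc mult_1_left mult_zero_left mult_minus_left)+
    have "?f (sl_mu (u \<otimes>\<^sub>v v)) = ?f u * ?f v" for u v
      by (simp add: sl_mu_nth scale A.scale_left_distrib A.scale_left_diff_distrib
          A.scale_minus_left algebra_simps rel rel')
    moreover have "Vector_Spaces.linear (*s) s ?f"
      by (intro Vector_Spaces.linear_iff[THEN iffD2])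
        (simp add: vec.vector_space_axioms assms(1) A.scale_left_distrib A.scale_right_distrib
          algebra_simps)
    ultimately show "Vector_Spaces.linear (*s) s ?f \<and> ?f sl_one = 1 \<and>
        (\<forall>u v. ?f (sl_mu (u \<otimes>\<^sub>v v)) = ?f u * ?f v) \<and> ?f sl_g = G \<and> ?f sl_x = X"
      by (simp add: sl_one_def sl_g_def sl_x_def axis_def)
  next
    fix f assume f: "Vector_Spaces.linear (*s) s f \<and> f sl_one = 1 \<and>
        (\<forall>u v. f (sl_mu (u \<otimes>\<^sub>v v)) = f u * f v) \<and> f sl_g = G \<and> f sl_x = X"
    then interpret f: Vector_Spaces.linear "(*s)" s f by simp
    have "f sl_gx = G * X" using f sl_mu_simps(7) by metis
    then show "f = (\<lambda>v. s (v $ I1) 1 + s (v $ Ig) G + s (v $ Ix) X + s (v $ Igx) (G * X))"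
      using f by (intro ext, subst sl_expand) (simp add: f.add f.scale)
  qed
qed

end

theory Submission
  imports Defs
begin

text \<open>
  Everything is finite-dimensional, so the cohomology is found by solving linear equations for the
  coefficients on the basis \<open>1, g, x, gx\<close>. As \<open>2\<close> is invertible, \<open>C\<^sup>1\<close> is spanned by the derivation
  \<open>g \<mapsto> 0\<close>, \<open>x \<mapsto> x\<close>, which commutes with \<open>ad\<close>; hence \<open>D\<^sub>1 = 0\<close> and \<open>H\<^sup>2\<close> is the space of
  cocycles. The condition \<open>d\<^sup>2\<^sup>,\<^sup>1 \<phi> = 0\<close> on \<open>u \<otimes> 1 \<otimes> 1\<close> gives \<open>\<phi>(u \<otimes> 1) = 0\<close>, on \<open>u \<otimes> g \<otimes> g\<close> it
  kills half of the coefficients of \<open>\<phi>(u \<otimes> g)\<close>, and together with \<open>d\<^sup>2\<^sup>,\<^sup>2 \<phi> = 0\<close> it leaves three free coefficients.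
\<close>

section \<open>The adjoint map and the coproduct in coordinates\<close>

lemma sl_basis_nth [simp]:
  "sl_one $ i = (if i = I1 then 1 else 0)" "sl_g $ i = (if i = Ig then 1 else 0)"
  "sl_x $ i = (if i = Ix then 1 else 0)" "sl_gx $ i = (if i = Igx then 1 else 0)"
  by (simp_all add: sl_one_def sl_g_def sl_x_def sl_gx_def axis_def)

lemma tensor_nth [simp]: "(u \<otimes>\<^sub>v v) $ (i, j) = u $ i * v $ j"
  by (simp add: tensor_def)

lemma tensor_diff [simp]:
  "(u - v) \<otimes>\<^sub>v w = u \<otimes>\<^sub>v w - v \<otimes>\<^sub>v w" "w \<otimes>\<^sub>v (u - v) = w \<otimes>\<^sub>v u - w \<otimes>\<^sub>v v"
  by (simp_all add: tensor_def vec_eq_iff algebra_simps)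

lemma sl_vec_eq_iff:
  "u = v \<longleftrightarrow> u $ I1 = v $ I1 \<and> u $ Ig = v $ Ig \<and> u $ Ix = v $ Ix \<and> u $ Igx = v $ Igx"
  unfolding vec_eq_iff by (metis (full_types) sl_index.exhaust)

abbreviation sl_ad :: "'k::field^(sl_index \<times> sl_index) \<Rightarrow> 'k^sl_index"
  where "sl_ad \<equiv> ad_map sl_mu sl_Delta sl_S"

lemma klinear_sl_ad: "klinear sl_ad"
  by (intro klinear_ad_map klinear_sl)

text \<open>The action of g is conjugation by g, which fixes 1 and g and negates x and gx. The
  actions of x and gx are v -> g(vx - xv) and v -> xvg + vgx; both vanish at 1, x and gx and send g
  to 2x.\<close>

lemma sl_ad_eq:
  "sl_ad (v \<otimes>\<^sub>v sl_one) = v"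
  "sl_ad (v \<otimes>\<^sub>v sl_g) = v $ I1 *s sl_one + v $ Ig *s sl_g - v $ Ix *s sl_x - v $ Igx *s sl_gx"
  "sl_ad (v \<otimes>\<^sub>v sl_x) = (2 * v $ Ig) *s sl_x"
  "sl_ad (v \<otimes>\<^sub>v sl_gx) = (2 * v $ Ig) *s sl_x"
  by (simp_all add: ad_map_def sl_lin_simps sl_vec_eq_iff sl_mu_nth)

text \<open>The vector is left arbitrary because coproducts are taken of unknown values of \<phi>
  and f; the equations become linear in their coordinates.\<close>

lemma sl_Delta_eq: "sl_Delta v = v $ I1 *s (sl_one \<otimes>\<^sub>v sl_one) + v $ Ig *s (sl_g \<otimes>\<^sub>v sl_g)
  + v $ Ix *s (sl_x \<otimes>\<^sub>v sl_one + sl_g \<otimes>\<^sub>v sl_x) + v $ Igx *s (sl_gx \<otimes>\<^sub>v sl_g + sl_one \<otimes>\<^sub>v sl_gx)"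
  by (subst sl_expand[of v]) (simp add: sl_lin_simps)

lemma klinear_zero: "klinear 0"
  by (rule klinearI) auto

lemma klinear_add_diff: "klinear f \<Longrightarrow> klinear g \<Longrightarrow> klinear (f + g)"
  "klinear f \<Longrightarrow> klinear g \<Longrightarrow> klinear (f - g)"
  by (rule klinearI; simp add: klinear_simps vec.scale_right_distrib vec.scale_right_diff_distrib)+

section \<open>The differentials on pure tensors\<close>

lemma d21_tensor:
  assumes "klinear \<phi>"
  shows "d21_ad sl_mu sl_Delta sl_S \<phi> ((u \<otimes>\<^sub>v v) \<otimes>\<^sub>v w) =
    sl_ad (\<phi> (u \<otimes>\<^sub>v v) \<otimes>\<^sub>v w) + \<phi> (sl_ad (u \<otimes>\<^sub>v v) \<otimes>\<^sub>v w) - \<phi> (u \<otimes>\<^sub>v sl_mu (v \<otimes>\<^sub>v w))"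
  by (simp add: d21_ad_def Let_def sl_lin_simps assms klinear_sl_ad)

definition sl_mult_Delta :: "'k::field^sl_index \<Rightarrow> 'k^sl_index \<Rightarrow> 'k^(sl_index \<times> sl_index)"
  \<comment> \<open>\<open>v\<^sub>1 \<otimes> h v\<^sub>2\<close>; with \<open>h = w\<^sub>1\<close> and \<open>v = \<phi>(u \<otimes> w\<^sub>2)\<close> it is the second term of \<open>d\<^sup>2\<^sup>,\<^sup>2\<close>\<close>
  where "sl_mult_Delta h v = ((id \<otimes>\<^sub>m sl_mu) \<circ> assocr \<circ> (flip \<otimes>\<^sub>m id) \<circ> assocl
    \<circ> (id \<otimes>\<^sub>m sl_Delta)) (h \<otimes>\<^sub>v v)"

lemma sl_mult_Delta_eq:
  "sl_mult_Delta h v = v $ I1 *s (sl_one \<otimes>\<^sub>v sl_mu (h \<otimes>\<^sub>v sl_one)) + v $ Ig *s (sl_g \<otimes>\<^sub>v sl_mu (h \<otimes>\<^sub>v sl_g))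
  + v $ Ix *s (sl_x \<otimes>\<^sub>v sl_mu (h \<otimes>\<^sub>v sl_one) + sl_g \<otimes>\<^sub>v sl_mu (h \<otimes>\<^sub>v sl_x))
  + v $ Igx *s (sl_gx \<otimes>\<^sub>v sl_mu (h \<otimes>\<^sub>v sl_g) + sl_one \<otimes>\<^sub>v sl_mu (h \<otimes>\<^sub>v sl_gx))"
  by (simp add: sl_mult_Delta_def sl_lin_simps sl_Delta_eq[of v])

text \<open>Only the second factor is specialised: each summand h \<otimes> w of its coproduct
  contributes one term \<open>sl_mult_Delta h (\<phi> (u \<otimes>\<^sub>v w))\<close>.\<close>

lemma d22_tensor:
  assumes "klinear \<phi>"
  shows "d22_ad sl_mu sl_Delta \<phi> (u \<otimes>\<^sub>v sl_one) =
    (\<phi> \<otimes>\<^sub>m sl_mu) (mid_flip (sl_Delta u \<otimes>\<^sub>v (sl_one \<otimes>\<^sub>v sl_one))) - sl_mult_Delta sl_one (\<phi> (u \<otimes>\<^sub>v sl_one))"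
  "d22_ad sl_mu sl_Delta \<phi> (u \<otimes>\<^sub>v sl_g) =
    (\<phi> \<otimes>\<^sub>m sl_mu) (mid_flip (sl_Delta u \<otimes>\<^sub>v (sl_g \<otimes>\<^sub>v sl_g))) - sl_mult_Delta sl_g (\<phi> (u \<otimes>\<^sub>v sl_g))"
  "d22_ad sl_mu sl_Delta \<phi> (u \<otimes>\<^sub>v sl_x) =
    (\<phi> \<otimes>\<^sub>m sl_mu) (mid_flip (sl_Delta u \<otimes>\<^sub>v (sl_x \<otimes>\<^sub>v sl_one + sl_g \<otimes>\<^sub>v sl_x)))
     - sl_mult_Delta sl_x (\<phi> (u \<otimes>\<^sub>v sl_one)) - sl_mult_Delta sl_g (\<phi> (u \<otimes>\<^sub>v sl_x))"
  "d22_ad sl_mu sl_Delta \<phi> (u \<otimes>\<^sub>v sl_gx) =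
    (\<phi> \<otimes>\<^sub>m sl_mu) (mid_flip (sl_Delta u \<otimes>\<^sub>v (sl_gx \<otimes>\<^sub>v sl_g + sl_one \<otimes>\<^sub>v sl_gx)))
     - sl_mult_Delta sl_gx (\<phi> (u \<otimes>\<^sub>v sl_g)) - sl_mult_Delta sl_one (\<phi> (u \<otimes>\<^sub>v sl_gx))"
  by (simp_all add: d22_ad_def sl_mult_Delta_def sl_lin_simps assms)

lemma klinear_d21: "klinear \<phi> \<Longrightarrow> klinear (d21_ad sl_mu sl_Delta sl_S \<phi>)"
  unfolding d21_ad_def Let_def
  by (intro klinear_add_diff klinear_compose klinear_tensor_map klinear_reindex klinear_sl_ad)

lemma klinear_d22: "klinear \<phi> \<Longrightarrow> klinear (d22_ad sl_mu sl_Delta \<phi>)"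
  unfolding d22_ad_def Let_def
  by (intro klinear_add_diff klinear_compose klinear_tensor_map klinear_reindex klinear_sl klinear_mid_flip)

section \<open>The space of 2-cocycles\<close>

definition sl_cocycle :: "'k::field \<Rightarrow> 'k \<Rightarrow> 'k \<Rightarrow> 'k^(sl_index \<times> sl_index) \<Rightarrow> 'k^sl_index"
  where "sl_cocycle a b c = lin_ext (\<lambda>p. case p of
      (Ig, Ix) \<Rightarrow> a *s sl_one
    | (Ig, Igx) \<Rightarrow> a *s sl_one
    | (Ix, Ig) \<Rightarrow> - a *s sl_one
    | (Igx, Ig) \<Rightarrow> b *s sl_g
    | (Igx, Ix) \<Rightarrow> c *s sl_one + b *s sl_x
    | (Igx, Igx) \<Rightarrow> - c *s sl_one + b *s sl_x
    | _ \<Rightarrow> 0)"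

lemma klinear_sl_cocycle: "klinear (sl_cocycle a b c)"
  by (simp add: sl_cocycle_def klinear_lin_ext)

lemma sl_cocycle_simps [simp]:
  "sl_cocycle a b c (sl_one \<otimes>\<^sub>v v) = 0"
  "sl_cocycle a b c (v \<otimes>\<^sub>v sl_one) = 0"
  "sl_cocycle a b c (sl_g \<otimes>\<^sub>v sl_g) = 0"
  "sl_cocycle a b c (sl_g \<otimes>\<^sub>v sl_x) = a *s sl_one"
  "sl_cocycle a b c (sl_g \<otimes>\<^sub>v sl_gx) = a *s sl_one"
  "sl_cocycle a b c (sl_x \<otimes>\<^sub>v sl_g) = - a *s sl_one"
  "sl_cocycle a b c (sl_x \<otimes>\<^sub>v sl_x) = 0"
  "sl_cocycle a b c (sl_x \<otimes>\<^sub>v sl_gx) = 0"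
  "sl_cocycle a b c (sl_gx \<otimes>\<^sub>v sl_g) = b *s sl_g"
  "sl_cocycle a b c (sl_gx \<otimes>\<^sub>v sl_x) = c *s sl_one + b *s sl_x"
  "sl_cocycle a b c (sl_gx \<otimes>\<^sub>v sl_gx) = - c *s sl_one + b *s sl_x"
  by (simp_all add: sl_cocycle_def lin_ext_def tensor_def UNIV_sl_index sum.cartesian_product[symmetric]
     flip: UNIV_Times_UNIV)

lemma sl_cocycle_in_Z2: "sl_cocycle a b c \<in> Z2_ad sl_mu sl_Delta sl_S"
proof -
  note lin = klinear_sl_cocycle[of a b c]
  have "d21_ad sl_mu sl_Delta sl_S (sl_cocycle a b c) = 0"
    by (rule klinear_sl3_eqI; (intro klinear_d21 lin klinear_zero)?)
      (elim insertE emptyE; hypsubst; simp add: d21_tensor[OF lin] sl_ad_eq klinear_simps[OF lin]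
        klinear_simps[OF klinear_sl_ad] sl_vec_eq_iff)
  moreover have "d22_ad sl_mu sl_Delta (sl_cocycle a b c) = 0"
    by (rule klinear_sl2_eqI; (intro klinear_d22 lin klinear_zero)?)
      (elim insertE emptyE; hypsubst; simp add: d22_tensor[OF lin] sl_mult_Delta_eq
        sl_lin_simps lin klinear_simps[OF lin] algebra_simps)
  ultimately show ?thesis by (simp add: Z2_ad_def C2_ad_def D2_ad_def lin prod_eq_iff zero_prod_def)
qed

lemma sl_Z2_eq_cocycle:
  fixes \<phi> :: "'k::field^(sl_index \<times> sl_index) \<Rightarrow> 'k^sl_index"
  assumes two: "(2::'k) \<noteq> 0" and Z: "\<phi> \<in> Z2_ad sl_mu sl_Delta sl_S"
  shows "\<phi> = sl_cocycle (\<phi> (sl_g \<otimes>\<^sub>v sl_x) $ I1)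
    (\<phi> (sl_gx \<otimes>\<^sub>v sl_g) $ Ig) (\<phi> (sl_gx \<otimes>\<^sub>v sl_x) $ I1)"
proof -
  have lin: "klinear \<phi>" and "d21_ad sl_mu sl_Delta sl_S \<phi> = 0" "d22_ad sl_mu sl_Delta \<phi> = 0"
    using Z by (auto simp: Z2_ad_def C2_ad_def D2_ad_def zero_prod_def)
  then have A: "sl_ad (\<phi> (u \<otimes>\<^sub>v v) \<otimes>\<^sub>v w) + \<phi> (sl_ad (u \<otimes>\<^sub>v v) \<otimes>\<^sub>v w) - \<phi> (u \<otimes>\<^sub>v sl_mu (v \<otimes>\<^sub>v w)) = 0"
    and "d22_ad sl_mu sl_Delta \<phi> (u \<otimes>\<^sub>v v) = 0" for u v w
    by (simp_all flip: d21_tensor[OF lin])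
  \<comment> \<open>The equation in H \<otimes> H is split into its sixteen coordinates.\<close>
  then have B: "\<forall>i\<in>{I1, Ig, Ix, Igx}. \<forall>j\<in>{I1, Ig, Ix, Igx}.
      d22_ad sl_mu sl_Delta \<phi> (u \<otimes>\<^sub>v v) $ (i, j) = 0" for u v
    by simp
  have one [simp]: "\<phi> (u \<otimes>\<^sub>v sl_one) = 0" for u
    using A[of u sl_one sl_one] by (simp add: sl_ad_eq)
  define p where "p u v i = \<phi> (u \<otimes>\<^sub>v v) $ i" for u v i
  note eqs = p_def[symmetric] lin klinear_simps[OF lin] sl_lin_simps sl_vec_eq_iff two
    klinear_simps[OF klinear_sl_ad] sl_ad_eq d22_tensor[OF lin] sl_mult_Delta_eq
  \<comment> \<open>On u \<otimes> g \<otimes> g, conjugation by g removes the 1 and g parts of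
    \<phi>(u \<otimes> g) for u = 1, g, and the x and gx parts for u = x, gx. Then
    \<open>d22_ad\<close> compares the coproduct of v = \<phi>(u \<otimes> g) with v \<otimes> 1 (u
    = 1, x) or v \<otimes> g (u = g, gx), so v is a multiple of 1 or of g respectively.\<close>
  have g: "\<phi> (sl_one \<otimes>\<^sub>v sl_g) = 0" "\<phi> (sl_g \<otimes>\<^sub>v sl_g) = 0"
    "\<phi> (sl_gx \<otimes>\<^sub>v sl_g) = p sl_gx sl_g Ig *s sl_g"
    and xg: "\<phi> (sl_x \<otimes>\<^sub>v sl_g) = p sl_x sl_g I1 *s sl_one"
    using A[of sl_one sl_g sl_g] A[of sl_g sl_g sl_g] A[of sl_x sl_g sl_g] A[of sl_gx sl_g sl_g]
      B[of sl_one sl_g] B[of sl_g sl_g] B[of sl_x sl_g] B[of sl_gx sl_g]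
    by (simp_all add: eqs)
  \<comment> \<open>By \<open>d22_ad\<close> both values are multiples of g, and ad(g \<otimes> x) =
    2x makes the multiples zero.\<close>
  have "\<phi> (sl_one \<otimes>\<^sub>v sl_x) = 0 \<and> \<phi> (sl_one \<otimes>\<^sub>v sl_gx) = 0"
    using B[of sl_one sl_x] B[of sl_one sl_gx]
      A[of sl_one sl_x sl_x] A[of sl_one sl_gx sl_x] g
    by (simp add: eqs)
  \<comment> \<open>Both values are multiples of 1 by \<open>d22_ad\<close>; they agree by
    \<open>d21_ad\<close> on g \<otimes> g \<otimes> x.\<close>
  moreover have "\<phi> (sl_g \<otimes>\<^sub>v sl_x) = p sl_g sl_x I1 *s sl_one
      \<and> \<phi> (sl_g \<otimes>\<^sub>v sl_gx) = p sl_g sl_x I1 *s sl_one"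
    using B[of sl_g sl_x] B[of sl_g sl_gx] A[of sl_g sl_g sl_x] A[of sl_g sl_x sl_g] g
    by (simp add: eqs)
  \<comment> \<open>Applied to x \<otimes> g \<otimes> x and x \<otimes> x \<otimes> g,
    \<open>d21_ad\<close> gives \<phi>(x \<otimes> gx) = -\<phi>(x \<otimes> x) and invariance under
    conjugation by g, so no x or gx part. The 1 part falls to \<open>d22_ad\<close>, the g part to x
    \<otimes> x \<otimes> x.\<close>
  moreover have xx: "\<phi> (sl_x \<otimes>\<^sub>v sl_x) = 0 \<and> \<phi> (sl_x \<otimes>\<^sub>v sl_gx) = 0"
    using B[of sl_x sl_x] A[of sl_x sl_g sl_x] A[of sl_x sl_x sl_g] A[of sl_x sl_x sl_x] xg
    by (simp add: eqs eq_neg_iff_add_eq_0 neg_eq_iff_add_eq_0)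
  \<comment> \<open>With \<phi>(x \<otimes> x) = 0, \<open>d22_ad\<close> on x \<otimes> x reduces
    to (\<phi>(x \<otimes> g) + \<phi>(g \<otimes> x)) \<otimes> x.\<close>
  moreover have "\<phi> (sl_x \<otimes>\<^sub>v sl_g) = - p sl_g sl_x I1 *s sl_one"
    using B[of sl_x sl_x] xx xg
    by (simp add: eqs eq_neg_iff_add_eq_0 add.commute)
  \<comment> \<open>Writing \<phi>(gx \<otimes> g) = bg, \<open>d22_ad\<close> leaves only a 1 part
    and the x part bx in each value. The 1 parts are opposite since \<open>d21_ad\<close> on gx
    \<otimes> g \<otimes> x says that the values add up to 2bx.\<close>
  moreover have "\<phi> (sl_gx \<otimes>\<^sub>v sl_x) = p sl_gx sl_x I1 *s sl_one + p sl_gx sl_g Ig *s sl_x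
      \<and> \<phi> (sl_gx \<otimes>\<^sub>v sl_gx) = - p sl_gx sl_x I1 *s sl_one + p sl_gx sl_g Ig *s sl_x"
    using B[of sl_gx sl_x] B[of sl_gx sl_gx]
      A[of sl_gx sl_g sl_x] A[of sl_gx sl_x sl_g] A[of sl_gx sl_x sl_x] g
    by (simp add: eqs)
  ultimately have vals: "\<phi> (sl_one \<otimes>\<^sub>v sl_x) = 0 \<and> \<phi> (sl_one \<otimes>\<^sub>v sl_gx) = 0
      \<and> \<phi> (sl_g \<otimes>\<^sub>v sl_x) = p sl_g sl_x I1 *s sl_one
      \<and> \<phi> (sl_g \<otimes>\<^sub>v sl_gx) = p sl_g sl_x I1 *s sl_one
      \<and> \<phi> (sl_x \<otimes>\<^sub>v sl_g) = - p sl_g sl_x I1 *s sl_one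
      \<and> \<phi> (sl_x \<otimes>\<^sub>v sl_x) = 0 \<and> \<phi> (sl_x \<otimes>\<^sub>v sl_gx) = 0
      \<and> \<phi> (sl_gx \<otimes>\<^sub>v sl_x) = p sl_gx sl_x I1 *s sl_one + p sl_gx sl_g Ig *s sl_x
      \<and> \<phi> (sl_gx \<otimes>\<^sub>v sl_gx) = - p sl_gx sl_x I1 *s sl_one + p sl_gx sl_g Ig *s sl_x"
    by blast
  have "\<phi> = sl_cocycle (p sl_g sl_x I1) (p sl_gx sl_g Ig) (p sl_gx sl_x I1)"
  proof (rule klinear_sl2_eqI[OF lin klinear_sl_cocycle])
    fix u v :: "'k^sl_index"
    assume "u \<in> {sl_one, sl_g, sl_x, sl_gx}" "v \<in> {sl_one, sl_g, sl_x, sl_gx}"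
    then show "\<phi> (u \<otimes>\<^sub>v v) = sl_cocycle (p sl_g sl_x I1) (p sl_gx sl_g Ig) (p sl_gx sl_x I1) (u \<otimes>\<^sub>v v)"
      by (elim insertE emptyE; hypsubst; simp add: g vals)
  qed
  then show ?thesis by (simp only: p_def)
qed

section \<open>Derivations and coboundaries\<close>

lemma sl_C1_cases:
  fixes f :: "'k::field^sl_index \<Rightarrow> 'k^sl_index"
  assumes two: "(2::'k) \<noteq> 0" and f: "f \<in> C1_ad sl_mu sl_Delta"
  obtains a where "f sl_one = 0" "f sl_g = 0" "f sl_x = a *s sl_x" "f sl_gx = a *s sl_gx"
proof -
  have lin: "klinear f" and eqs: "f \<circ> sl_mu = (sl_mu \<circ> (f \<otimes>\<^sub>m id)) + (sl_mu \<circ> (id \<otimes>\<^sub>m f))"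
    "sl_Delta \<circ> f = ((f \<otimes>\<^sub>m id) \<circ> sl_Delta) + ((id \<otimes>\<^sub>m f) \<circ> sl_Delta)"
    using f by (auto simp: C1_ad_def)
  have D: "f (sl_mu (u \<otimes>\<^sub>v v)) = sl_mu (f u \<otimes>\<^sub>v v) + sl_mu (u \<otimes>\<^sub>v f v)" for u v
    using fun_cong[OF eqs(1), of "u \<otimes>\<^sub>v v"] by (simp add: tensor_map_tensor lin klinear_id)
  have C: "\<forall>i\<in>{I1, Ig, Ix, Igx}. \<forall>j\<in>{I1, Ig, Ix, Igx}. sl_Delta (f u) $ (i, j) =
    (f \<otimes>\<^sub>m id) (sl_Delta u) $ (i, j) + (id \<otimes>\<^sub>m f) (sl_Delta u) $ (i, j)" for u
    using fun_cong[OF eqs(2), of u] by simp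
  have one: "f sl_one = 0"
    using D[of sl_one sl_one] by (simp add: hopf_algebra.unit_left[OF hopf_algebra_superline]
        hopf_algebra.unit_right[OF hopf_algebra_superline])
  \<comment> \<open>The Leibniz rule for gg = 1 kills the 1 and g parts, the coproduct condition the
    x and gx parts.\<close>
  moreover have g: "f sl_g = 0"
    using D[of sl_g sl_g] C[of sl_g] one two
    by (simp add: sl_vec_eq_iff sl_mu_nth sl_Delta_eq[of "f _"] sl_lin_simps lin
        klinear_simps[OF lin])
  \<comment> \<open>The coproduct condition makes f(x) skew-primitive, so it lies in the span of 1 -
    g and x; the Leibniz rule for the relations on x removes 1 - g.\<close>
  moreover have x: "f sl_x = f sl_x $ Ix *s sl_x"
    using D[of sl_x sl_x] D[of sl_x sl_g] D[of sl_g sl_x] C[of sl_x] one g two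
    by (simp add: sl_vec_eq_iff sl_mu_nth sl_Delta_eq[of "f _"] sl_lin_simps lin
        klinear_simps[OF lin])
  moreover have "f sl_gx = f sl_x $ Ix *s sl_gx"
    using D[of sl_g sl_x] one g
    by (simp, subst x) (simp add: sl_lin_simps)
  ultimately show thesis by (rule that)
qed

text \<open>Such an f multiplies by a times the degree in x, where 1 and g have degree 0 and x and
  gx degree 1. The adjoint map preserves total degree, so the three terms of \<open>D1_ad\<close>
  cancel.\<close>

lemma sl_B2_eq_zero:
  assumes two: "(2::'k::field) \<noteq> 0"
  shows "B2_ad sl_mu (sl_Delta :: 'k^sl_index \<Rightarrow> _) sl_S = {0}"
proof -
  have "D1_ad sl_mu sl_Delta sl_S f = 0" if f: "f \<in> C1_ad sl_mu sl_Delta"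
    for f :: "'k^sl_index \<Rightarrow> 'k^sl_index"
  proof -
    have lin: "klinear f" using f by (simp add: C1_ad_def)
    obtain a where [simp]: "f sl_one = 0" "f sl_g = 0" "f sl_x = a *s sl_x"  "f sl_gx = a *s sl_gx"
      using sl_C1_cases[OF two f] .
    show ?thesis
    proof (rule klinear_sl2_eqI)
      show "klinear (D1_ad sl_mu sl_Delta sl_S f)"
        unfolding D1_ad_def Let_def
        by (intro klinear_add_diff klinear_compose klinear_sl_ad klinear_tensor_map lin)
    next
      fix u v :: "'k^sl_index"
      assume "u \<in> {sl_one, sl_g, sl_x, sl_gx}" "v \<in> {sl_one, sl_g, sl_x, sl_gx}"
      then show "D1_ad sl_mu sl_Delta sl_S f (u \<otimes>\<^sub>v v) = 0 (u \<otimes>\<^sub>v v)"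
        by (elim insertE emptyE; hypsubst; simp add: D1_ad_def Let_def tensor_map_tensor lin klinear_id
            sl_ad_eq klinear_simps[OF klinear_sl_ad] klinear_simps[OF lin] sl_vec_eq_iff)
    qed (rule klinear_zero)
  qed
  then have "B2_ad sl_mu (sl_Delta :: 'k^sl_index \<Rightarrow> _) sl_S \<subseteq> {0}" by (auto simp: B2_ad_def)
  then show ?thesis using B2_ad_zero[OF klinear_sl(1,2)] by blast
qed

text \<open>If 2 = 0, the characteristic divides the prime 2; it is not 2, and 1 is impossible in a
  field.\<close>

lemma two_neq_zero_of_CHAR:
  assumes "CHAR('k::field) \<noteq> 2"
  shows "(2::'k) \<noteq> 0"
proof
  assume "(2::'k) = 0"
  then have "CHAR('k) dvd 2" using of_nat_eq_0_iff_char_dvd[of 2, where 'a = 'k] by simp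
  then have "CHAR('k) = 1" using assms two_is_prime_nat by (auto simp: prime_nat_iff)
  then show False by simp
qed

theorem proposition5p13:
  assumes "CHAR('k::field) \<noteq> 2"
  shows "\<exists>\<Psi> :: ('k^(sl_index \<times> sl_index) \<Rightarrow> 'k^sl_index) set \<Rightarrow> 'k^3.
    bij_betw \<Psi> (H2_ad sl_mu sl_Delta sl_S) UNIV \<and>
    (\<forall>X\<in>H2_ad sl_mu sl_Delta sl_S. \<forall>Y\<in>H2_ad sl_mu sl_Delta sl_S.
      \<Psi> (X + Y) = \<Psi> X + \<Psi> Y) \<and>
    (\<forall>c. \<forall>X\<in>H2_ad sl_mu sl_Delta sl_S.
      \<Psi> (H2_scale sl_mu sl_Delta sl_S c X) = c *s \<Psi> X)"
proof -
  let ?Z = "Z2_ad sl_mu sl_Delta sl_S :: ('k^(sl_index \<times> sl_index) \<Rightarrow> 'k^sl_index) set"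
  have two: "(2::'k) \<noteq> 0" by (rule two_neq_zero_of_CHAR) fact
  note B = sl_B2_eq_zero[OF two]
  define coords :: "('k^(sl_index \<times> sl_index) \<Rightarrow> 'k^sl_index) \<Rightarrow> 'k^3" where
    "coords \<phi> = vector [\<phi> (sl_g \<otimes>\<^sub>v sl_x) $ I1, \<phi> (sl_gx \<otimes>\<^sub>v sl_g) $ Ig, \<phi> (sl_gx \<otimes>\<^sub>v sl_x) $ I1]" for \<phi>
  \<comment> \<open>As the coboundaries vanish, each class is a singleton and
    \<open>the_elem\<close> returns its only cocycle.\<close>
  define \<Psi> where "\<Psi> X = coords (the_elem X)" for X
  have H2: "H2_ad sl_mu sl_Delta sl_S = (\<lambda>\<phi>. {\<phi>}) ` ?Z"
    by (simp add: H2_ad_def B set_plus_def)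
  have \<Psi>: "\<Psi> {\<phi>} = coords \<phi>" for \<phi> by (simp add: \<Psi>_def)
  have inv: "sl_cocycle (coords \<phi> $ 1) (coords \<phi> $ 2) (coords \<phi> $ 3) = \<phi>" if "\<phi> \<in> ?Z" for \<phi>
    using sl_Z2_eq_cocycle[OF two that] by (simp add: coords_def)
  have "coords (sl_cocycle (v $ 1) (v $ 2) (v $ 3)) = v" for v :: "'k^3"
    by (simp add: coords_def vec_eq_iff forall_3)
  then have "bij_betw \<Psi> (H2_ad sl_mu sl_Delta sl_S) UNIV"
    by (intro bij_betw_byWitness[of _ "\<lambda>v. {sl_cocycle (v $ 1) (v $ 2) (v $ 3)}"])
      (auto simp: H2 \<Psi> inv sl_cocycle_in_Z2)
  moreover have "\<Psi> ({\<phi>} + {\<psi>}) = \<Psi> {\<phi>} + \<Psi> {\<psi>}" for \<phi> \<psi>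
    by (simp add: set_plus_def \<Psi> coords_def vec_eq_iff forall_3)
  moreover have "\<Psi> (H2_scale sl_mu sl_Delta sl_S c {\<phi>}) = c *s \<Psi> {\<phi>}" for c \<phi>
    by (simp add: H2_scale_def B set_plus_def \<Psi> coords_def vec_eq_iff forall_3)
  ultimately show ?thesis by (auto simp: H2)
qed

end
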